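(* Assume the setting below. For $0\le j\le d$ let $Q_j$ be the matrix obtained from $Q$ by replacing its $j$-th column (columns indexed $0,\dots,d$) by $[1,0,0,\dots,0]^T$. Then $X$ is invertible if and only if $\det(Q)\neq 0$. Furthermore, if $\det(Q)\neq0$, then, setting $$y_i=\sum_{j=i}^d(-1)^{j-i}\binom{j}{i}k^{j-i}\frac{\det(Q_j)}{\det(Q)}\quad(0\le i\le d),$$ the inverse of $X$ is $$X^{-1}=\sum_{i=0}^d y_iA^i=\sum_{i=0}^d\left(\sum_{j=i}^d(-1)^{j-i}\binom{j}{i}k^{j-i}\frac{\det(Q_j)}{\det(Q)}\right)A^i.$$
   Context: Setting: Let $d\ge 2$ and $k\ge 3$ be integers. Let numbers $c_i,a_i,b_i$ ($-1\le i\le d+1$) satisfy $c_{-1}=c_0=0$, $c_1=1$, $c_{d+1}=0$, $b_{-1}=0$, $b_0=k$, $b_d=b_{d+1}=0$, $a_0=0$, $k=c_i+a_i+b_i$ for all $-1\le i\le d+1$, $1=c_1\le c_2\le\cdots\le c_d\le k$ and $k=b_0\ge b_1\ge\cdots\ge b_{d-1}\ge 1$. Let $A_{-1}=\mathbf 0, A_0,A_1,\dots,A_d,A_{d+1}=\mathbf 0$ be $n\times n$ matrices with $A_0=I$, $A_1=A$, $A\mathbf j=k\mathbf j$ (where $\mathbf j$ is the all-ones column vector), the minimal polynomial of $A$ has degree at least $d+1$, $J=A_0+A_1+\cdots+A_d$ (with $J$ the all-ones matrix), and $AA_i=b_{i-1}A_{i-1}+a_iA_i+c_{i+1}A_{i+1}$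 for $0\le i\le d$. Let $\{x_{i,j}: 0\le i\le d,\,-1\le j\le d+1\}$ be numbers with $x_{i,-1}=x_{i,d+1}=0$ for $0\le i\le d$ and $x_{i+1,j}=(x_{i,j+1}-x_{i,j})b_j-(x_{i,j}-x_{i,j-1})c_j$ for $0\le i\le d-1$, $0\le j\le d$ (the values $x_{0,j}$, $0\le j\le d$, are arbitrary). Let $X=\sum_{j=0}^d x_{0,j}A_j$. Let $Q=(x'_{i,j})_{0\le i,j\le d}$ with $x'_{i,j}=x_{j,i}$. *)

theory Defs
  imports
    Complex_Main
    "Jordan_Normal_Form.Determinant"
begin

text \<open>Matrices of a fixed size do not form a type, so \<open>\<Sum>\<close> is not available for them; the sum of a
  family of \<open>n \<times> n\<close> matrices is taken entrywise.\<close>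

definition mat_sum :: "nat \<Rightarrow> ('i \<Rightarrow> 'a :: comm_monoid_add mat) \<Rightarrow> 'i set \<Rightarrow> 'a mat" where
  "mat_sum n F I = mat n n (\<lambda>rc. \<Sum>i\<in>I. F i $$ rc)"

lemma mat_sum_empty: "mat_sum n F {} = 0\<^sub>m n n"
  by (rule eq_matI) (auto simp: mat_sum_def)

lemma mat_sum_insert:
  assumes "finite I" "i \<notin> I" "F i \<in> carrier_mat n n"
  shows "mat_sum n F (insert i I) = F i + mat_sum n F I"
  using assms by (intro eq_matI) (auto simp: mat_sum_def)

definition mat_poly :: "'a :: comm_ring_1 poly \<Rightarrow> 'a mat \<Rightarrow> 'a mat" where
  "mat_poly p M = mat_sum (dim_row M) (\<lambda>i. coeff p i \<cdot>\<^sub>m (M ^\<^sub>m i)) {0..degree p}"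

definition is_minimal_poly :: "'a :: field mat \<Rightarrow> 'a poly \<Rightarrow> bool" where
  "is_minimal_poly M p \<longleftrightarrow>
     lead_coeff p = 1 \<and> mat_poly p M = 0\<^sub>m (dim_row M) (dim_row M) \<and>
     (\<forall>q. q \<noteq> 0 \<and> mat_poly q M = 0\<^sub>m (dim_row M) (dim_row M) \<longrightarrow> degree p \<le> degree q)"

end

theory Submission
  imports Defs
begin

text \<open>Put \<open>B = A - k I\<close>. The three-term recurrence for the \<open>A\<^sub>i\<close>, together with \<open>k = c\<^sub>i + a\<^sub>i + b\<^sub>i\<close>,
  says that \<open>B\<close> sends the combination of the \<open>A\<^sub>j\<close> with coefficients \<open>x\<^sub>i\<^sub>j\<close> to the one with coefficients
  \<open>x\<^bsub>i+1,j\<^esub>\<close>, so column \<open>i\<close> of \<open>Q\<close> lists the coefficients of \<open>B\<^sup>i X\<close>. If \<open>Q z = e\<^sub>0\<close>, then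
  \<open>(\<Sum> z\<^sub>j B\<^sup>j) X = A\<^sub>0 = I\<close>; Cramer's rule gives \<open>z\<close>, and expanding \<open>B\<^sup>j\<close> by the binomial theorem gives
  the \<open>y\<^sub>i\<close>. If \<open>Q z = 0\<close> with \<open>z \<noteq> 0\<close> while \<open>X\<close> is invertible, then \<open>\<Sum> z\<^sub>j B\<^sup>j = 0\<close>, so a nonzero
  polynomial of degree at most \<open>d\<close> annihilates \<open>A\<close>.\<close>

section \<open>Entrywise sums and their products with a matrix\<close>

lemma mat_sum_carrier [simp]: "mat_sum n F I \<in> carrier_mat n n"
  by (simp add: mat_sum_def)

lemma mat_sum_dim [simp]: "dim_row (mat_sum n F I) = n" "dim_col (mat_sum n F I) = n"
  by (simp_all add: mat_sum_def)

lemma mat_sum_index [simp]: "r < n \<Longrightarrow> s < n \<Longrightarrow> mat_sum n F I $$ (r, s) = (\<Sum>i\<in>I. F i $$ (r, s))"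
  by (simp add: mat_sum_def)

lemma index_mult_mat_sum:
  assumes "M \<in> carrier_mat n n" "N \<in> carrier_mat n n" "r < n" "s < n"
  shows "(M * N) $$ (r, s) = (\<Sum>t<n. M $$ (r, t) * N $$ (t, s))"
  using assms by (auto simp: scalar_prod_def lessThan_atLeast0 intro!: sum.cong)

lemma mat_sum_cong:
  "(\<And>i. i \<in> I \<Longrightarrow> F i = G i) \<Longrightarrow> mat_sum n F I = mat_sum n G I"
  by (auto simp: mat_sum_def)

lemma mult_mat_sum:
  fixes M :: "'a :: comm_semiring_1 mat"
  assumes M: "M \<in> carrier_mat n n" and F: "\<And>i. i \<in> I \<Longrightarrow> F i \<in> carrier_mat n n"
  shows "M * mat_sum n F I = mat_sum n (\<lambda>i. M * F i) I"
proof (rule eq_matI)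
  fix r s assume "r < dim_row (mat_sum n (\<lambda>i. M * F i) I)" "s < dim_col (mat_sum n (\<lambda>i. M * F i) I)"
  then have rs: "r < n" "s < n" by simp_all
  have "(M * mat_sum n F I) $$ (r, s) = (\<Sum>t<n. \<Sum>i\<in>I. M $$ (r, t) * F i $$ (t, s))"
    using rs by (simp add: index_mult_mat_sum[OF M mat_sum_carrier] sum_distrib_left)
  also have "\<dots> = (\<Sum>i\<in>I. \<Sum>t<n. M $$ (r, t) * F i $$ (t, s))" by (rule sum.swap)
  also have "\<dots> = (\<Sum>i\<in>I. (M * F i) $$ (r, s))"
    using rs by (intro sum.cong) (simp_all add: index_mult_mat_sum[OF M F])
  finally show "(M * mat_sum n F I) $$ (r, s) = mat_sum n (\<lambda>i. M * F i) I $$ (r, s)"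
    using rs by simp
qed (use M in auto)

lemma mat_sum_mult:
  fixes M :: "'a :: comm_semiring_1 mat"
  assumes M: "M \<in> carrier_mat n n" and F: "\<And>i. i \<in> I \<Longrightarrow> F i \<in> carrier_mat n n"
  shows "mat_sum n F I * M = mat_sum n (\<lambda>i. F i * M) I"
proof (rule eq_matI)
  fix r s assume "r < dim_row (mat_sum n (\<lambda>i. F i * M) I)" "s < dim_col (mat_sum n (\<lambda>i. F i * M) I)"
  then have rs: "r < n" "s < n" by simp_all
  have "(mat_sum n F I * M) $$ (r, s) = (\<Sum>t<n. \<Sum>i\<in>I. F i $$ (r, t) * M $$ (t, s))"
    using rs by (simp add: index_mult_mat_sum[OF mat_sum_carrier M] sum_distrib_right)
  also have "\<dots> = (\<Sum>i\<in>I. \<Sum>t<n. F i $$ (r, t) * M $$ (t, s))" by (rule sum.swap)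
  also have "\<dots> = (\<Sum>i\<in>I. (F i * M) $$ (r, s))"
    using rs by (intro sum.cong) (simp_all add: index_mult_mat_sum[OF F M])
  finally show "(mat_sum n F I * M) $$ (r, s) = mat_sum n (\<lambda>i. F i * M) I $$ (r, s)"
    using rs by simp
qed (use M in auto)

section \<open>Powers of a shifted matrix and the change of polynomial basis\<close>

text \<open>Binomial theorem, available because scalar matrices commute with \<open>A\<close>. It is
  stated entrywise so that all sums live in the coefficient ring; the induction splits off one
  factor on the right and applies Pascal's rule.\<close>

lemma pow_mat_shift_index:
  fixes A :: "'a :: comm_ring_1 mat"
  assumes A: "A \<in> carrier_mat n n" and rs: "r < n" "s < n"
  shows "((A - \<kappa> \<cdot>\<^sub>m 1\<^sub>m n) ^\<^sub>m j) $$ (r, s) =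
    (\<Sum>i\<le>j. of_nat (j choose i) * (- \<kappa>) ^ (j - i) * (A ^\<^sub>m i) $$ (r, s))"
  using rs
proof (induction j arbitrary: r s)
  case 0
  then show ?case using A by simp
next
  case (Suc j)
  let ?B = "A - \<kappa> \<cdot>\<^sub>m 1\<^sub>m n" and ?p = "\<lambda>i. (A ^\<^sub>m i) $$ (r, s)"
  have B: "?B \<in> carrier_mat n n" and Bj: "?B ^\<^sub>m j \<in> carrier_mat n n" using A by auto
  have pow_Suc: "(\<Sum>t<n. (A ^\<^sub>m i) $$ (r, t) * A $$ (t, s)) = ?p (Suc i)" for i
    using index_mult_mat_sum[of "A ^\<^sub>m i" n A r s] A Suc.prems by simp
  have "(?B ^\<^sub>m j * A) $$ (r, s) =
      (\<Sum>t<n. \<Sum>i\<le>j. of_nat (j choose i) * (- \<kappa>) ^ (j - i) * ((A ^\<^sub>m i) $$ (r, t) * A $$ (t, s)))"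
    using Suc by (simp add: index_mult_mat_sum[OF Bj A] sum_distrib_right mult.assoc)
  also have "\<dots> = (\<Sum>i\<le>j. of_nat (j choose i) * (- \<kappa>) ^ (j - i) * ?p (Suc i))"
    by (subst sum.swap) (simp add: sum_distrib_left[symmetric] pow_Suc)
  finally have shifted:
    "(?B ^\<^sub>m j * A) $$ (r, s) = (\<Sum>i\<le>j. of_nat (j choose i) * (- \<kappa>) ^ (j - i) * ?p (Suc i))" .
  have "?B ^\<^sub>m Suc j = ?B ^\<^sub>m j * A - \<kappa> \<cdot>\<^sub>m (?B ^\<^sub>m j)"
    using mult_minus_distrib_mat[OF Bj A, of "\<kappa> \<cdot>\<^sub>m 1\<^sub>m n"] Bj
      mult_smult_distrib[OF Bj one_carrier_mat, of \<kappa>] by simp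
  then have "(?B ^\<^sub>m Suc j) $$ (r, s) = (?B ^\<^sub>m j * A) $$ (r, s) + (- \<kappa>) * (?B ^\<^sub>m j) $$ (r, s)"
    using Suc.prems A Bj by simp
  also have "(- \<kappa>) * (?B ^\<^sub>m j) $$ (r, s) =
      (\<Sum>i\<le>j. of_nat (j choose i) * (- \<kappa>) ^ (Suc j - i) * ?p i)"
    by (simp add: Suc.IH[OF Suc.prems] sum_distrib_left Suc_diff_le mult_ac)
  \<comment> \<open>The added term \<open>i = Suc j\<close> is zero because
    \<open>j choose Suc j\<close> is. Splitting off \<open>i = 0\<close> next lines this sum up with
    \<open>shifted\<close>, so that Pascal's rule applies term by term.\<close>
  also have "\<dots> = (\<Sum>i\<le>Suc j. of_nat (j choose i) * (- \<kappa>) ^ (Suc j - i) * ?p i)"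
    by (simp add: binomial_eq_0)
  also have "\<dots> = (- \<kappa>) ^ Suc j * ?p 0 +
      (\<Sum>i\<le>j. of_nat (j choose Suc i) * (- \<kappa>) ^ (j - i) * ?p (Suc i))"
    by (subst sum.atMost_Suc_shift) simp
  also have "(?B ^\<^sub>m j * A) $$ (r, s) + \<dots> = (- \<kappa>) ^ Suc j * ?p 0 +
      (\<Sum>i\<le>j. of_nat (Suc j choose Suc i) * (- \<kappa>) ^ (j - i) * ?p (Suc i))"
    unfolding shifted by (simp add: sum.distrib algebra_simps)
  also have "\<dots> = (\<Sum>i\<le>Suc j. of_nat (Suc j choose i) * (- \<kappa>) ^ (Suc j - i) * ?p i)"
    by (simp add: sum.atMost_Suc_shift del: sum.atMost_Suc)
  finally show ?case .
qed

text \<open>This is the coefficient of \<open>t^i\<close> in the polynomial given by the sum of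
  \<open>z j * (t - \<kappa>)^j\<close> over \<open>j \<le> d\<close>. With
  \<open>\<kappa> = k\<close> and \<open>z j = det (Qs j) / det Q\<close> it becomes
  \<open>y i\<close>.\<close>

definition shift_coeff :: "'a :: comm_ring_1 \<Rightarrow> nat \<Rightarrow> (nat \<Rightarrow> 'a) \<Rightarrow> nat \<Rightarrow> 'a" where
  "shift_coeff \<kappa> d z i = (\<Sum>j = i..d. of_nat (j choose i) * (- \<kappa>) ^ (j - i) * z j)"

lemma mat_sum_shift_coeff:
  fixes A :: "'a :: comm_ring_1 mat"
  assumes A: "A \<in> carrier_mat n n"
  shows "mat_sum n (\<lambda>i. shift_coeff \<kappa> d z i \<cdot>\<^sub>m (A ^\<^sub>m i)) {0..d} =
    mat_sum n (\<lambda>j. z j \<cdot>\<^sub>m ((A - \<kappa> \<cdot>\<^sub>m 1\<^sub>m n) ^\<^sub>m j)) {0..d}" (is "?L = ?R")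
proof (rule eq_matI)
  fix r s assume "r < dim_row ?R" "s < dim_col ?R"
  then have rs: "r < n" "s < n" by simp_all
  let ?B = "A - \<kappa> \<cdot>\<^sub>m 1\<^sub>m n"
  let ?f = "\<lambda>j i. of_nat (j choose i) * (- \<kappa>) ^ (j - i) * z j * (A ^\<^sub>m i) $$ (r, s)"
  have dims: "dim_row (A ^\<^sub>m i) = n" "dim_col (A ^\<^sub>m i) = n"
    "dim_row (?B ^\<^sub>m i) = n" "dim_col (?B ^\<^sub>m i) = n" for i
    using A pow_carrier_mat[of A n i] pow_carrier_mat[of ?B n i] by auto
  have "?R $$ (r, s) = (\<Sum>j\<in>{0..d}. \<Sum>i\<in>{0..j}. ?f j i)"
    using rs by (simp add: dims pow_mat_shift_index[OF A] sum_distrib_left atLeast0AtMost mult_ac)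
  \<comment> \<open>Both double sums run over the triangle \<open>i \<le> j \<le> d\<close>, first
    by rows, then by columns.\<close>
  also have "\<dots> = (\<Sum>i\<in>{0..d}. \<Sum>j\<in>{i..d}. ?f j i)"
    unfolding sum.Sigma[OF finite_atLeastAtMost ballI[OF finite_atLeastAtMost]]
    by (rule sum.reindex_bij_witness[of _ "\<lambda>(i, j). (j, i)" "\<lambda>(j, i). (i, j)"]) auto
  also have "\<dots> = ?L $$ (r, s)"
    using rs A by (simp add: dims shift_coeff_def sum_distrib_right)
  finally show "?L $$ (r, s) = ?R $$ (r, s)" by simp
qed simp_all

text \<open>The change of basis is unitriangular: \<open>shift_coeff \<kappa> d z j\<close> is
  \<open>z j\<close> plus a combination of entries of larger index. Back substitution from
  \<open>d\<close> downwards therefore shows injectivity.\<close>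

lemma shift_coeff_eq_0_imp:
  assumes "\<And>i. i \<le> d \<Longrightarrow> shift_coeff \<kappa> d z i = 0" "j \<le> d"
  shows "z j = 0"
  using assms(2)
proof (induction "d - j" arbitrary: j rule: less_induct)
  case less
  have "shift_coeff \<kappa> d z j = z j + (\<Sum>i = Suc j..d. of_nat (i choose j) * (- \<kappa>) ^ (i - j) * z i)"
    unfolding shift_coeff_def using less.prems by (subst sum.atLeast_Suc_atMost) auto
  also have "(\<Sum>i = Suc j..d. of_nat (i choose j) * (- \<kappa>) ^ (i - j) * z i) = 0"
    using less by (intro sum.neutral) auto
  finally show ?case using assms(1)[OF less.prems] by simp
qed

section \<open>Linear independence of low powers of a matrix\<close>

lemma mat_poly_eq_mat_sum:
  assumes A: "A \<in> carrier_mat n n" and deg: "degree p \<le> d"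
  shows "mat_poly p A = mat_sum n (\<lambda>i. coeff p i \<cdot>\<^sub>m (A ^\<^sub>m i)) {0..d}"
proof (rule eq_matI)
  have dims: "dim_row (A ^\<^sub>m i) = n" "dim_col (A ^\<^sub>m i) = n" for i
    using A pow_carrier_mat[of A n i] by auto
  fix r s assume "r < dim_row (mat_sum n (\<lambda>i. coeff p i \<cdot>\<^sub>m (A ^\<^sub>m i)) {0..d})"
    "s < dim_col (mat_sum n (\<lambda>i. coeff p i \<cdot>\<^sub>m (A ^\<^sub>m i)) {0..d})"
  then show "mat_poly p A $$ (r, s) = mat_sum n (\<lambda>i. coeff p i \<cdot>\<^sub>m (A ^\<^sub>m i)) {0..d} $$ (r, s)"
    using A deg by (auto simp: mat_poly_def dims coeff_eq_0 intro!: sum.mono_neutral_left)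
qed (use A in \<open>auto simp: mat_poly_def\<close>)

text \<open>A nontrivial relation among the powers up to \<open>d\<close> would be a nonzero
  annihilating polynomial of degree at most \<open>d\<close>, below the degree of
  \<open>\<mu>\<close>.\<close>

lemma minimal_poly_imp_coeffs_eq_0:
  assumes A: "A \<in> carrier_mat n n" and min: "is_minimal_poly A \<mu>" "degree \<mu> \<ge> d + 1"
    and zero: "mat_sum n (\<lambda>i. w i \<cdot>\<^sub>m (A ^\<^sub>m i)) {0..d} = 0\<^sub>m n n" and i: "i \<le> d"
  shows "w i = 0"
proof (rule ccontr)
  assume wi: "w i \<noteq> 0"
  define p where "p = (\<Sum>i\<le>d. monom (w i) i)"
  have coeff_p: "coeff p j = (if j \<le> d then w j else 0)" for j
    by (simp add: p_def coeff_sum)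
  then have deg: "degree p \<le> d" by (intro degree_le) auto
  have "mat_poly p A = mat_sum n (\<lambda>i. w i \<cdot>\<^sub>m (A ^\<^sub>m i)) {0..d}"
    unfolding mat_poly_eq_mat_sum[OF A deg] by (rule mat_sum_cong) (simp add: coeff_p)
  moreover have "p \<noteq> 0" using wi i coeff_p[of i] by auto
  ultimately show False using min deg zero A unfolding is_minimal_poly_def by fastforce
qed

section \<open>The three-term recurrence as an action on coefficients\<close>

lemma sum_int_shift_up:
  fixes g :: "int \<Rightarrow> 'a :: ab_group_add"
  shows "(\<Sum>j = 0..int d. g (j + 1)) = (\<Sum>j = 0..int d. g j) - g 0 + g (int d + 1)"
proof (induction d)
  case (Suc d)
  have "{0..int (Suc d)} = insert (int d + 1) {0..int d}" by auto
  with Suc show ?case by (simp add: algebra_simps)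
qed simp

text \<open>The boundary values of \<open>As\<close> and \<open>u\<close> outside \<open>{0..d}\<close> do not matter here: the coefficients
  \<open>b\<close> and \<open>c\<close> multiplying them vanish.\<close>

lemma shift_mult_mat_sum:
  fixes A :: "'a :: real_field mat"
  assumes A: "A \<in> carrier_mat n n"
    and As: "\<And>i. -1 \<le> i \<Longrightarrow> i \<le> int d + 1 \<Longrightarrow> As i \<in> carrier_mat n n"
    and bd: "c 0 = 0" "c (int d + 1) = 0" "b (-1) = 0" "b (int d) = 0"
    and k_sum: "\<And>i. 0 \<le> i \<Longrightarrow> i \<le> int d \<Longrightarrow> \<kappa> = of_real (c i + a i + b i)"
    and A_rec: "\<And>i. 0 \<le> i \<Longrightarrow> i \<le> int d \<Longrightarrow>
      A * As i = of_real (b (i - 1)) \<cdot>\<^sub>m As (i - 1) + of_real (a i) \<cdot>\<^sub>m As i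
                   + of_real (c (i + 1)) \<cdot>\<^sub>m As (i + 1)"
  shows "(A - \<kappa> \<cdot>\<^sub>m 1\<^sub>m n) * mat_sum n (\<lambda>j. u j \<cdot>\<^sub>m As j) {0..int d} =
    mat_sum n (\<lambda>j. ((u (j + 1) - u j) * of_real (b j) - (u j - u (j - 1)) * of_real (c j)) \<cdot>\<^sub>m As j)
      {0..int d}" (is "?B * ?U = ?V")
proof (rule eq_matI)
  fix r s assume "r < dim_row ?V" "s < dim_col ?V"
  then have rs: "r < n" "s < n" by simp_all
  define e where "e = (\<lambda>i. As i $$ (r, s))"
  have dims: "dim_row (As i) = n" "dim_col (As i) = n" if "-1 \<le> i" "i \<le> int d + 1" for i
    using As[OF that] by auto
  have U: "?U \<in> carrier_mat n n" by simp
  have "?B * ?U = A * ?U - \<kappa> \<cdot>\<^sub>m ?U"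
    using A by (subst minus_mult_distrib_mat[OF A _ U])
      (simp_all add: mult_smult_assoc_mat[OF one_carrier_mat U] left_mult_one_mat[OF U])
  moreover have "A * ?U = mat_sum n (\<lambda>j. u j \<cdot>\<^sub>m (A * As j)) {0..int d}"
    using mult_smult_distrib[OF A As] As by (subst mult_mat_sum[OF A]) (auto intro!: mat_sum_cong)
  ultimately have "(?B * ?U) $$ (r, s) =
      (\<Sum>j = 0..int d. u j * (A * As j) $$ (r, s)) - \<kappa> * (\<Sum>j = 0..int d. u j * e j)"
    using rs A by (simp add: e_def dims)
  also have "(\<Sum>j = 0..int d. u j * (A * As j) $$ (r, s)) =
      (\<Sum>j = 0..int d. u j * of_real (b (j - 1)) * e (j - 1)) + (\<Sum>j = 0..int d. u j * of_real (a j) * e j)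
        + (\<Sum>j = 0..int d. u j * of_real (c (j + 1)) * e (j + 1))"
    using rs by (simp add: A_rec e_def dims sum.distrib[symmetric] algebra_simps)
  \<comment> \<open>Summation by parts moves the index shift from \<open>e\<close> to
    \<open>u\<close>. The boundary terms carry the factors \<open>b (-1)\<close> and
    \<open>b d\<close> here, and \<open>c 0\<close> and \<open>c (d + 1)\<close> in the sum after
    it.\<close>
  also have "(\<Sum>j = 0..int d. u j * of_real (b (j - 1)) * e (j - 1)) =
      (\<Sum>j = 0..int d. u (j + 1) * of_real (b j) * e j)"
    using sum_int_shift_up[of "\<lambda>j. u j * of_real (b (j - 1)) * e (j - 1)" d] bd by simp
  also have "(\<Sum>j = 0..int d. u j * of_real (c (j + 1)) * e (j + 1)) =
      (\<Sum>j = 0..int d. u (j - 1) * of_real (c j) * e j)"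
    using sum_int_shift_up[of "\<lambda>j. u (j - 1) * of_real (c j) * e j" d] bd by simp
  \<comment> \<open>Splitting \<open>\<kappa>\<close> separately for each \<open>j\<close> cancels
    the \<open>a\<close> terms and turns the rest into differences of neighbouring values of
    \<open>u\<close>.\<close>
  also have "\<kappa> * (\<Sum>j = 0..int d. u j * e j) =
      (\<Sum>j = 0..int d. of_real (c j + a j + b j) * (u j * e j))"
    unfolding sum_distrib_left by (rule sum.cong) (use k_sum[symmetric] in simp_all)
  finally have "(?B * ?U) $$ (r, s) = (\<Sum>j = 0..int d.
      ((u (j + 1) - u j) * of_real (b j) - (u j - u (j - 1)) * of_real (c j)) * e j)"
    by (simp add: sum.distrib[symmetric] sum_subtractf[symmetric] algebra_simps)
  then show "(?B * ?U) $$ (r, s) = ?V $$ (r, s)"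
    using rs by (simp add: e_def dims)
qed (use A in auto)

section \<open>Invertibility of \<open>X\<close> and its inverse as a polynomial in
  \<open>A\<close>\<close>

theorem theorem3:
  fixes d k n :: nat
    and c a b :: "int \<Rightarrow> real"
    and A :: "'a :: real_field mat"
    and As :: "int \<Rightarrow> 'a mat"
    and \<mu> :: "'a poly"
    and x :: "nat \<Rightarrow> int \<Rightarrow> 'a"
    and X Q :: "'a mat"
    and Qs :: "nat \<Rightarrow> 'a mat"
    and y :: "nat \<Rightarrow> 'a"
  assumes d: "d \<ge> 2" and k: "k \<ge> 3"
    and c_bd: "c (-1) = 0" "c 0 = 0" "c 1 = 1" "c (int d + 1) = 0"
    and b_bd: "b (-1) = 0" "b 0 = real k" "b (int d) = 0" "b (int d + 1) = 0"
    and a0: "a 0 = 0"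
    and k_sum: "\<And>i. -1 \<le> i \<Longrightarrow> i \<le> int d + 1 \<Longrightarrow> real k = c i + a i + b i"
    and c_mono: "\<And>i. 1 \<le> i \<Longrightarrow> i \<le> int d - 1 \<Longrightarrow> c i \<le> c (i + 1)" "c (int d) \<le> real k"
    and b_mono: "\<And>i. 0 \<le> i \<Longrightarrow> i \<le> int d - 2 \<Longrightarrow> b i \<ge> b (i + 1)" "b (int d - 1) \<ge> 1"
    and As_dim: "\<And>i. -1 \<le> i \<Longrightarrow> i \<le> int d + 1 \<Longrightarrow> As i \<in> carrier_mat n n"
    and As_bd: "As (-1) = 0\<^sub>m n n" "As 0 = 1\<^sub>m n" "As 1 = A" "As (int d + 1) = 0\<^sub>m n n"
    and Aj: "A *\<^sub>v vec n (\<lambda>_. 1) = of_nat k \<cdot>\<^sub>v vec n (\<lambda>_. 1)"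
    and min_poly: "is_minimal_poly A \<mu>" "degree \<mu> \<ge> d + 1"
    and J: "mat n n (\<lambda>_. 1) = mat_sum n As {0..int d}"
    and A_rec: "\<And>i. 0 \<le> i \<Longrightarrow> i \<le> int d \<Longrightarrow>
      A * As i = of_real (b (i - 1)) \<cdot>\<^sub>m As (i - 1) + of_real (a i) \<cdot>\<^sub>m As i
                   + of_real (c (i + 1)) \<cdot>\<^sub>m As (i + 1)"
    and x_bd: "\<And>i. i \<le> d \<Longrightarrow> x i (-1) = 0" "\<And>i. i \<le> d \<Longrightarrow> x i (int d + 1) = 0"
    and x_rec: "\<And>i j. i < d \<Longrightarrow> 0 \<le> j \<Longrightarrow> j \<le> int d \<Longrightarrow>
      x (i + 1) j = (x i (j + 1) - x i j) * of_real (b j) - (x i j - x i (j - 1)) * of_real (c j)"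
    and X: "X = mat_sum n (\<lambda>j. x 0 j \<cdot>\<^sub>m As j) {0..int d}"
    and Q: "Q = mat (d + 1) (d + 1) (\<lambda>(i, j). x j (int i))"
    and Qs: "\<And>j. j \<le> d \<Longrightarrow> Qs j = replace_col Q (unit_vec (d + 1) 0) j"
    and y: "\<And>i. i \<le> d \<Longrightarrow>
      y i = (\<Sum>j = i..d. (-1) ^ (j - i) * of_nat (j choose i) * of_nat k ^ (j - i) * (det (Qs j) / det Q))"
  shows "(invertible_mat X \<longleftrightarrow> det Q \<noteq> 0) \<and>
    (det Q \<noteq> 0 \<longrightarrow>
       inverts_mat X (mat_sum n (\<lambda>i. y i \<cdot>\<^sub>m (A ^\<^sub>m i)) {0..d}) \<and>
       inverts_mat (mat_sum n (\<lambda>i. y i \<cdot>\<^sub>m (A ^\<^sub>m i)) {0..d}) X)"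
proof -
  define B where "B = A - of_nat k \<cdot>\<^sub>m 1\<^sub>m n"
  define Y where "Y i = mat_sum n (\<lambda>j. x i j \<cdot>\<^sub>m As j) {0..int d}" for i
  define P where "P z = mat_sum n (\<lambda>j. z j \<cdot>\<^sub>m (B ^\<^sub>m j)) {0..d}" for z
  have A: "A \<in> carrier_mat n n" using As_dim[of 1] As_bd by simp
  then have B: "B \<in> carrier_mat n n" by (auto simp: B_def)
  have Xc: "X \<in> carrier_mat n n" and Qc: "Q \<in> carrier_mat (d + 1) (d + 1)" by (simp_all add: X Q)
  have P_carrier: "P z \<in> carrier_mat n n" for z by (simp add: P_def)
  have step: "B * Y i = Y (Suc i)" if "i < d" for i
  proof -
    have "B * Y i = mat_sum n
        (\<lambda>j. ((x i (j + 1) - x i j) * of_real (b j) - (x i j - x i (j - 1)) * of_real (c j)) \<cdot>\<^sub>m As j)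
        {0..int d}"
      unfolding B_def Y_def
    proof (rule shift_mult_mat_sum[where a = a])
      show "of_nat k = (of_real (c i + a i + b i) :: 'a)" if "0 \<le> i" "i \<le> int d" for i
        using that k_sum[of i, symmetric] by simp
    qed (use A As_dim c_bd b_bd A_rec in auto)
    also have "\<dots> = Y (Suc i)"
      unfolding Y_def by (rule mat_sum_cong) (use x_rec[OF that] in simp)
    finally show ?thesis .
  qed
  \<comment> \<open>Only \<open>i = 0\<close> is used later, where \<open>Y 0\<close> is
    \<open>X\<close>. The induction needs arbitrary \<open>i\<close>, since the rightmost factor
    \<open>B\<close> is absorbed into \<open>Y i\<close> first.\<close>
  have pow: "B ^\<^sub>m j * Y i = Y (i + j)" if "i + j \<le> d" for i j
    using that
  proof (induction j arbitrary: i)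
    case 0
    then show ?case using B by (simp add: Y_def)
  next
    case (Suc j)
    have "B ^\<^sub>m Suc j * Y i = B ^\<^sub>m j * (B * Y i)"
      using assoc_mult_mat[of "B ^\<^sub>m j" n n B n "Y i" n] B by (simp add: Y_def)
    with Suc show ?case by (simp add: step)
  qed
  \<comment> \<open>Key identity: column \<open>j\<close> of \<open>Q\<close> holds the coefficients
    of \<open>B^j X\<close>, so weighting these columns by \<open>v\<close> gives the coefficients
    \<open>Q v\<close>. It is applied with \<open>Q v = 0\<close> and with \<open>Q v\<close> the
    first unit vector.\<close>
  have P_mult_X: "P (vec_index v) * X = mat_sum n (\<lambda>i. (Q *\<^sub>v v) $ nat i \<cdot>\<^sub>m As i) {0..int d}"
    if v: "v \<in> carrier_vec (d + 1)" for v
  proof -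
    have "P (vec_index v) * X = mat_sum n (\<lambda>j. (v $ j \<cdot>\<^sub>m B ^\<^sub>m j) * X) {0..d}"
      unfolding P_def using B by (intro mat_sum_mult[OF Xc]) auto
    also have "\<dots> = mat_sum n (\<lambda>j. v $ j \<cdot>\<^sub>m Y j) {0..d}"
    proof (rule mat_sum_cong)
      fix j assume "j \<in> {0..d}"
      then have "B ^\<^sub>m j * X = Y j" using pow[of 0 j] by (simp add: X Y_def)
      then show "(v $ j \<cdot>\<^sub>m B ^\<^sub>m j) * X = v $ j \<cdot>\<^sub>m Y j"
        using mult_smult_assoc_mat[of "B ^\<^sub>m j" n n X n] B Xc by simp
    qed
    also have "\<dots> = mat_sum n (\<lambda>i. (Q *\<^sub>v v) $ nat i \<cdot>\<^sub>m As i) {0..int d}" (is "?L = ?R")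
    proof (rule eq_matI)
      fix r s assume "r < dim_row ?R" "s < dim_col ?R"
      then have rs: "r < n" "s < n" by simp_all
      have dims: "dim_row (As i) = n" "dim_col (As i) = n" if "0 \<le> i" "i \<le> int d" for i
        using As_dim[of i] that by auto
      have Qv: "(Q *\<^sub>v v) $ nat i = (\<Sum>j\<in>{0..d}. x j i * v $ j)" if "0 \<le> i" "i \<le> int d" for i
        using that v by (simp add: Q scalar_prod_def nat_less_iff atLeast0AtMost atLeast0LessThan
            lessThan_Suc_atMost del: sum.op_ivl_Suc)
      have "?L $$ (r, s) = (\<Sum>j\<in>{0..d}. \<Sum>i\<in>{0..int d}. x j i * v $ j * As i $$ (r, s))"
        using rs by (simp add: Y_def dims sum_distrib_left mult_ac)
      also have "\<dots> = (\<Sum>i\<in>{0..int d}. \<Sum>j\<in>{0..d}. x j i * v $ j * As i $$ (r, s))"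
        by (rule sum.swap)
      also have "\<dots> = ?R $$ (r, s)"
        using rs by (simp add: dims Qv sum_distrib_right)
      finally show "?L $$ (r, s) = ?R $$ (r, s)" .
    qed simp_all
    finally show ?thesis .
  qed
  have P_eq: "P z = mat_sum n (\<lambda>i. shift_coeff (of_nat k) d z i \<cdot>\<^sub>m (A ^\<^sub>m i)) {0..d}" for z
    unfolding P_def B_def by (rule mat_sum_shift_coeff[OF A, symmetric])
  have det_nz: "det Q \<noteq> 0" if inv_X: "invertible_mat X"
  proof
    assume "det Q = 0"
    then obtain v where v: "v \<in> carrier_vec (d + 1)" "v \<noteq> 0\<^sub>v (d + 1)" "Q *\<^sub>v v = 0\<^sub>v (d + 1)"
      using det_0_iff_vec_prod_zero[OF Qc] by blast
    obtain W where XW: "X * W = 1\<^sub>m n" and WX: "W * X = 1\<^sub>m (dim_row W)"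
      using inv_X carrier_matD(1)[OF Xc] unfolding invertible_mat_def inverts_mat_def by metis
    \<comment> \<open>\<open>invertible_mat\<close> does not fix the size of the inverse; it is read
      off from the dimensions of both sides of \<open>XW\<close> and \<open>WX\<close>.\<close>
    have W: "W \<in> carrier_mat n n"
      using arg_cong[OF XW, of dim_col] arg_cong[OF WX, of dim_col] Xc by auto
    have "P (vec_index v) * X = 0\<^sub>m n n"
    proof (rule eq_matI)
      fix r s assume "r < dim_row (0\<^sub>m n n :: 'a mat)" "s < dim_col (0\<^sub>m n n :: 'a mat)"
      then have rs: "r < n" "s < n" by simp_all
      have "((0\<^sub>v (d + 1) $ nat i) \<cdot>\<^sub>m As i) $$ (r, s) = 0" if "i \<in> {0..int d}" for i
        using As_dim[of i] that rs by (auto simp: nat_less_iff)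
      then show "(P (vec_index v) * X) $$ (r, s) = 0\<^sub>m n n $$ (r, s)"
        unfolding P_mult_X[OF v(1)] v(3) using rs by simp
    qed (use P_carrier Xc in auto)
    then have "P (vec_index v) * (X * W) = 0\<^sub>m n n"
      using W by (simp flip: assoc_mult_mat[OF P_carrier Xc W])
    then have "P (vec_index v) = 0\<^sub>m n n"
      using XW by (simp add: right_mult_one_mat[OF P_carrier])
    \<comment> \<open>Rewritten in powers of \<open>A\<close>, the relation must be trivial by the
      degree of \<open>\<mu>\<close>; unitriangularity then forces \<open>v\<close> itself to
      vanish.\<close>
    then have "shift_coeff (of_nat k) d (vec_index v) i = 0" if "i \<le> d" for i
      using minimal_poly_imp_coeffs_eq_0[OF A min_poly _ that] unfolding P_eq by blast
    then have "v $ j = 0" if "j \<le> d" for j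
      using shift_coeff_eq_0_imp that by blast
    then have "v = 0\<^sub>v (d + 1)" using v(1) by (intro eq_vecI) auto
    then show False using v(2) by simp
  qed
  let ?I = "mat_sum n (\<lambda>i. y i \<cdot>\<^sub>m (A ^\<^sub>m i)) {0..d}"
  have inv: "?I * X = 1\<^sub>m n" "X * ?I = 1\<^sub>m n" if det: "det Q \<noteq> 0"
  proof -
    obtain R where R: "R \<in> carrier_mat (d + 1) (d + 1)" "Q * R = 1\<^sub>m (d + 1)"
      using det_non_zero_imp_unit[OF Qc det, of "()"] by (auto simp: Units_def ring_mat_def)
    define z where "z = R *\<^sub>v unit_vec (d + 1) 0"
    have z: "z \<in> carrier_vec (d + 1)" using R by (simp add: z_def)
    have Qz: "Q *\<^sub>v z = unit_vec (d + 1) 0"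
      unfolding z_def using R Qc by (simp add: assoc_mult_mat_vec[symmetric])
    \<comment> \<open>Since \<open>Q z\<close> is the first unit vector, \<open>Qs j\<close> is
      \<open>Q\<close> with column \<open>j\<close> replaced by \<open>Q z\<close>, and its
      determinant is \<open>z $ j * det Q\<close>.\<close>
    have cramer: "det (Qs j) / det Q = z $ j" if "j \<le> d" for j
      using cramer_lemma_mat[OF Qc z, of j] that det by (simp add: Qs Qz)
    have "y i = shift_coeff (of_nat k) d (vec_index z) i" if "i \<le> d" for i
      unfolding shift_coeff_def y[OF that] 
      by (rule sum.cong) (simp_all add: cramer power_minus[of "of_nat k"])
    then have "?I = P (vec_index z)"
      unfolding P_eq by (intro mat_sum_cong) simp
    then have "?I * X = mat_sum n (\<lambda>i. unit_vec (d + 1) 0 $ nat i \<cdot>\<^sub>m As i) {0..int d}"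
      using P_mult_X[OF z] Qz by simp
    \<comment> \<open>Only the term \<open>i = 0\<close> survives, and \<open>As 0\<close> is the
      identity.\<close>
    also have "\<dots> = 1\<^sub>m n"
    proof (rule eq_matI)
      fix r s assume "r < dim_row (1\<^sub>m n :: 'a mat)" "s < dim_col (1\<^sub>m n :: 'a mat)"
      then have rs: "r < n" "s < n" by simp_all
      have "(unit_vec (d + 1) 0 $ nat i \<cdot>\<^sub>m As i) $$ (r, s) = (if i = 0 then As 0 $$ (r, s) else 0)"
        if "i \<in> {0..int d}" for i
        using As_dim[of i] that rs by (auto simp: nat_less_iff unit_vec_def)
      then show "mat_sum n (\<lambda>i. unit_vec (d + 1) 0 $ nat i \<cdot>\<^sub>m As i) {0..int d} $$ (r, s) = 1\<^sub>m n $$ (r, s)"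
        using rs As_bd by simp
    qed simp_all
    finally show left: "?I * X = 1\<^sub>m n" .
    \<comment> \<open>For square matrices over a field a left inverse is also a right
      inverse.\<close>
    show "X * ?I = 1\<^sub>m n"
      by (rule mat_mult_left_right_inverse[OF mat_sum_carrier Xc left])
  qed
  then have "det Q \<noteq> 0 \<Longrightarrow> invertible_mat X \<and> inverts_mat X ?I \<and> inverts_mat ?I X"
    using Xc unfolding invertible_mat_def inverts_mat_def by auto
  with det_nz show ?thesis by blast
qed

end
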